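(* Let $\alpha,\beta,\gamma\in(0,1)$ and, for $\bm x\in[0,\infty)^3$, write $L=\left(x_2^{1/\beta}+x_3^{1/\beta}\right)^\beta-x_2$ and let $$g(\bm x)=\begin{cases}(1/\alpha)x_2-(1/\alpha-1)x_1+(1/\gamma)L,&0\le x_1\le x_2,\\[4pt] x_2+(1/\gamma)\max\left\{(x_1-x_2)/\alpha,L\right\}-(1/\gamma-1)\min\left\{(x_1-x_2)/\alpha,L\right\},&0\le x_2<x_1,\end{cases}$$ the gauge function of the trivariate vine copula with $C_{12}$ logistic (parameter $\alpha$), $C_{23}$ inverted logistic (parameter $\beta$) and $C_{13|2}$ logistic (parameter $\gamma$). Let $\eta_{\{1,2,3\}}=\{\min_{\bm x:\min(\bm x)\ge1}g(\bm x)\}^{-1}$ and $\eta_{\{1,3\}}=\{\min_{x_1,x_3\ge1,\,x_2\ge0}g(\bm x)\}^{-1}$. Then $$\eta_{\{1,2,3\}}=1/2^\beta,$$ and $$\eta_{\{1,3\}}=\left(1+v^{1/\beta}\right)^{-\beta},$$ where $v$ is the unique root in $[0,\infty)$ of $(1+v^{1/\beta})^\beta-(1-v)/\alpha-v=0$, and $v\in(0,1)$.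
   Context: Logistic and inverted logistic copulas are the extreme value copula $C(u,v)=\exp\{-V(\frac{-1}{\ln u},\frac{-1}{\ln v})\}$ and inverted extreme value copula $C(u,v)=u+v-1+\exp[-V\{\frac{-1}{\ln(1-u)},\frac{-1}{\ln(1-v)}\}]$ with exponent measure $V(x,y)=(x^{-1/\alpha}+y^{-1/\alpha})^\alpha$. The gauge function of a joint density $f$ with standard exponential margins is the function $g$, homogeneous of order 1, with $-\ln f(t\bm x)\sim tg(\bm x)$ as $t\to\infty$. Coefficients of tail dependence $\eta$ are taken in their gauge-function form as in the claim. *)

theory Defs
  imports "HOL-Analysis.Analysis"
begin

definition vine_L :: "real \<Rightarrow> real^3 \<Rightarrow> real" where
  "vine_L \<beta> x = ((x$2) powr (1/\<beta>) + (x$3) powr (1/\<beta>)) powr \<beta> - x$2"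

text \<open>Closed form of the gauge function of the trivariate vine copula with logistic
  \<open>C\<^sub>1\<^sub>2\<close> (parameter \<open>\<alpha>\<close>), inverted logistic \<open>C\<^sub>2\<^sub>3\<close> (parameter \<open>\<beta>\<close>) and logistic
  copula of the first and third variables given the second (parameter \<open>\<gamma>\<close>). Only the values
  on the nonnegative orthant are meaningful.\<close>

definition vine_gauge :: "real \<Rightarrow> real \<Rightarrow> real \<Rightarrow> real^3 \<Rightarrow> real" where
  "vine_gauge \<alpha> \<beta> \<gamma> x =
    (if x$1 \<le> x$2
     then (1/\<alpha>) * x$2 - (1/\<alpha> - 1) * x$1 + (1/\<gamma>) * vine_L \<beta> x
     else x$2 + (1/\<gamma>) * max ((x$1 - x$2) / \<alpha>) (vine_L \<beta> x)
              - (1/\<gamma> - 1) * min ((x$1 - x$2) / \<alpha>) (vine_L \<beta> x))"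

definition tail_region :: "3 set \<Rightarrow> (real^3) set" where
  "tail_region C = {x. (\<forall>i. 0 \<le> x$i) \<and> (\<forall>i\<in>C. 1 \<le> x$i)}"

text \<open>The least element of the image is the minimum of \<open>g\<close> over the region. It is an
  unspecified value if the minimum is not attained, so statements about \<open>tail_eta\<close> should
  come with \<open>attains_min\<close>.\<close>

definition attains_min :: "(real^3 \<Rightarrow> real) \<Rightarrow> 3 set \<Rightarrow> bool" where
  "attains_min g C \<longleftrightarrow> (\<exists>x\<in>tail_region C. \<forall>y\<in>tail_region C. g x \<le> g y)"

definition tail_eta :: "(real^3 \<Rightarrow> real) \<Rightarrow> 3 set \<Rightarrow> real" where
  "tail_eta g C = inverse (LEAST m. m \<in> g ` tail_region C)"

end

theory Submission
  imports Defs
begin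

text \<open>
  Write \<open>N y z = (y\<^sup>p + z\<^sup>p)\<^bsup>1/p\<^esup>\<close> with \<open>p = 1/\<beta>\<close> (below \<open>pnorm \<beta>\<close>), so that \<open>L = N x\<^sub>2 x\<^sub>3 - x\<^sub>2 \<ge> 0\<close>,
  and \<open>A = (x\<^sub>1 - x\<^sub>2)/\<alpha>\<close>. Since \<open>1/\<gamma> \<ge> 1\<close>, the inequality \<open>max A L / \<gamma> - (1/\<gamma> - 1) * min A L \<ge> max A L\<close> holds, with
  equality for \<open>A = L\<close>. Therefore \<open>\<gamma>\<close> drops out of the minimisation: the gauge on the orthant is at least
  \<open>x\<^sub>2 + L = N x\<^sub>2 x\<^sub>3\<close> (\<open>vine_gauge_ge_pnorm\<close>), for \<open>x\<^sub>1 > x\<^sub>2\<close> it is also at least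
  \<open>x\<^sub>2 + (x\<^sub>1 - x\<^sub>2)/\<alpha>\<close> (\<open>vine_gauge_ge_affine\<close>), and it equals \<open>N x\<^sub>2 x\<^sub>3\<close> on the
  surface \<open>x\<^sub>1 = x\<^sub>2 + \<alpha> L\<close>, where the two bounds coincide (\<open>vine_gauge_eq_pnorm\<close>).

  If all coordinates are at least 1, then \<open>N x\<^sub>2 x\<^sub>3 \<ge> N 1 1 = 2\<^bsup>\<beta>\<^esup>\<close>, and the point of the surface
  with \<open>x\<^sub>2 = x\<^sub>3 = 1\<close> attains this value.

  If \<open>x\<^sub>2\<close> is only nonnegative, the two bounds compete: at \<open>x\<^sub>1 = x\<^sub>3 = 1\<close> the first,
  \<open>N x\<^sub>2 1\<close>, increases in \<open>x\<^sub>2\<close>, while the second, \<open>x\<^sub>2 + (1 - x\<^sub>2)/\<alpha>\<close>, decreases because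
  \<open>\<alpha> < 1\<close>. Their maximum is smallest where they cross, and the equation defining \<open>v\<close> says
  exactly that they cross at \<open>x\<^sub>2 = v\<close>. This also means that \<open>(1, v, 1)\<close> lies on the surface, so
  the minimum is \<open>N v 1\<close>. Monotonicity makes the crossing unique, and the signs of the difference at
  0 and 1 place it in the open unit interval.
\<close>

definition pnorm :: "real \<Rightarrow> real \<Rightarrow> real \<Rightarrow> real" where
  "pnorm \<beta> y z = (y powr (1/\<beta>) + z powr (1/\<beta>)) powr \<beta>"

lemma vine_L_pnorm: "vine_L \<beta> x = pnorm \<beta> (x$2) (x$3) - x$2"
  by (simp add: vine_L_def pnorm_def)

lemma pnorm_mono:
  assumes "0 < \<beta>" "0 \<le> y" "y \<le> y'" "0 \<le> z" "z \<le> z'"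
  shows "pnorm \<beta> y z \<le> pnorm \<beta> y' z'"
  unfolding pnorm_def using assms
  by (intro powr_mono2 add_mono add_nonneg_nonneg) auto

lemma pnorm_ge_left:
  assumes "0 < \<beta>" "0 \<le> y"
  shows "y \<le> pnorm \<beta> y z"
proof -
  have "y = (y powr (1/\<beta>)) powr \<beta>"
    using assms by (simp add: powr_powr)
  also have "\<dots> \<le> pnorm \<beta> y z"
    unfolding pnorm_def using assms by (intro powr_mono2) auto
  finally show ?thesis .
qed

lemma weighted_max_min_ge_max:
  fixes a b \<gamma> :: real
  assumes "0 < \<gamma>" "\<gamma> \<le> 1"
  shows "max a b \<le> (1/\<gamma>) * max a b - (1/\<gamma> - 1) * min a b"
proof -
  have "0 \<le> (1/\<gamma> - 1) * (max a b - min a b)"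
    using assms by (intro mult_nonneg_nonneg) auto
  then show ?thesis by (simp add: algebra_simps)
qed

text \<open>For \<open>x$1 \<le> x$2\<close>, lowering \<open>x$1\<close> only adds to the gauge, and \<open>L\<close> enters with
  the weight \<open>1/\<gamma> \<ge> 1\<close>; for \<open>x$1 > x$2\<close> the maximum in the gauge dominates \<open>L\<close>.\<close>

lemma vine_gauge_ge_pnorm:
  assumes "0 < \<alpha>" "\<alpha> \<le> 1" "0 < \<beta>" "0 < \<gamma>" "\<gamma> \<le> 1" "0 \<le> x$2"
  shows "pnorm \<beta> (x$2) (x$3) \<le> vine_gauge \<alpha> \<beta> \<gamma> x"
proof (cases "x$1 \<le> x$2")
  case True
  have "0 \<le> (1/\<alpha> - 1) * (x$2 - x$1)"
    using assms True by (intro mult_nonneg_nonneg) auto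
  moreover have "0 \<le> (1/\<gamma> - 1) * vine_L \<beta> x"
    using assms pnorm_ge_left by (intro mult_nonneg_nonneg) (auto simp: vine_L_pnorm)
  ultimately have "x$2 + vine_L \<beta> x \<le> vine_gauge \<alpha> \<beta> \<gamma> x"
    using True by (simp add: vine_gauge_def algebra_simps)
  then show ?thesis by (simp add: vine_L_pnorm)
next
  case False
  have "vine_L \<beta> x \<le> max ((x$1 - x$2) / \<alpha>) (vine_L \<beta> x)" by simp
  also note weighted_max_min_ge_max[OF assms(4,5)]
  finally show ?thesis using False by (simp add: vine_gauge_def vine_L_pnorm)
qed

lemma vine_gauge_ge_affine:
  assumes "0 < \<gamma>" "\<gamma> \<le> 1" "x$2 < x$1"
  shows "x$2 + (x$1 - x$2) / \<alpha> \<le> vine_gauge \<alpha> \<beta> \<gamma> x"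
proof -
  have "(x$1 - x$2) / \<alpha> \<le> max ((x$1 - x$2) / \<alpha>) (vine_L \<beta> x)" by simp
  also note weighted_max_min_ge_max[OF assms(1,2)]
  finally show ?thesis using assms(3) by (simp add: vine_gauge_def)
qed

lemma vine_gauge_eq_pnorm:
  assumes "0 < \<alpha>" "0 < \<beta>" "0 \<le> x$2" "x$1 = x$2 + \<alpha> * vine_L \<beta> x"
  shows "vine_gauge \<alpha> \<beta> \<gamma> x = pnorm \<beta> (x$2) (x$3)"
proof -
  have L: "0 \<le> vine_L \<beta> x"
    using assms pnorm_ge_left by (simp add: vine_L_pnorm)
  show ?thesis
  proof (cases "vine_L \<beta> x = 0")
    \<comment> \<open>Here \<open>x$1 = x$2\<close>, so the first branch of the gauge applies.\<close>
    case True
    then show ?thesis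
      using assms by (simp add: vine_gauge_def vine_L_pnorm algebra_simps)
  next
    case False
    then have "0 < \<alpha> * vine_L \<beta> x" using L assms(1) by simp
    then have "x$2 < x$1" using assms(4) by linarith
    moreover have "(x$1 - x$2) / \<alpha> = vine_L \<beta> x" using assms(1,4) by simp
    ultimately have "vine_gauge \<alpha> \<beta> \<gamma> x = x$2 + vine_L \<beta> x"
      by (simp add: vine_gauge_def algebra_simps)
    then show ?thesis by (simp add: vine_L_pnorm)
  qed
qed

lemma tail_eta_minimizer:
  assumes "x \<in> tail_region C" "\<And>y. y \<in> tail_region C \<Longrightarrow> g x \<le> g y"
  shows "attains_min g C" "tail_eta g C = inverse (g x)"
proof -
  show "attains_min g C" using assms by (auto simp: attains_min_def)
  have "(LEAST m. m \<in> g ` tail_region C) = g x"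
    using assms by (intro Least_equality) auto
  then show "tail_eta g C = inverse (g x)" by (simp add: tail_eta_def)
qed

lemma tail_eta_123:
  assumes "0 < \<alpha>" "\<alpha> \<le> 1" "0 < \<beta>" "0 < \<gamma>" "\<gamma> \<le> 1"
  defines "g \<equiv> vine_gauge \<alpha> \<beta> \<gamma>"
  shows "attains_min g {1, 2, 3}" "tail_eta g {1, 2, 3} = 1 / 2 powr \<beta>"
proof -
  define x :: "real^3" where "x = vector [1 + \<alpha> * (2 powr \<beta> - 1), 1, 1]"
  have x: "x$1 = 1 + \<alpha> * (2 powr \<beta> - 1)" "x$2 = 1" "x$3 = 1"
    by (simp_all add: x_def)
  have p: "pnorm \<beta> 1 1 = 2 powr \<beta>" by (simp add: pnorm_def)
  have "0 \<le> \<alpha> * (2 powr \<beta> - 1)"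
    using assms by (intro mult_nonneg_nonneg) (auto intro: ge_one_powr_ge_zero)
  then have reg: "x \<in> tail_region {1, 2, 3}"
    by (auto simp: tail_region_def forall_3 x)
  have gx: "g x = 2 powr \<beta>"
    using assms x p vine_gauge_eq_pnorm[of \<alpha> \<beta> x \<gamma>] by (simp add: vine_L_pnorm)
  have min: "g x \<le> g y" if "y \<in> tail_region {1, 2, 3}" for y
  proof -
    have y: "1 \<le> y$2" "1 \<le> y$3" using that by (auto simp: tail_region_def)
    have "pnorm \<beta> 1 1 \<le> pnorm \<beta> (y$2) (y$3)"
      using assms y by (intro pnorm_mono) auto
    also have "\<dots> \<le> g y"
      unfolding g_def using assms y by (intro vine_gauge_ge_pnorm) auto
    finally show ?thesis by (simp add: gx p)
  qed
  show "attains_min g {1, 2, 3}" "tail_eta g {1, 2, 3} = 1 / 2 powr \<beta>"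
    using tail_eta_minimizer[where g = g, OF reg min] by (simp_all add: gx divide_inverse)
qed

text \<open>To the right of the crossing point \<open>v\<close> the increasing bound \<open>pnorm\<close> exceeds its value there,
  and to the left the decreasing affine bound does; on the left \<open>x$2 < v \<le> 1 \<le> x$1\<close>, so the
  affine bound is indeed available.\<close>

lemma tail_eta_13:
  assumes "0 < \<alpha>" "\<alpha> \<le> 1" "0 < \<beta>" "0 < \<gamma>" "\<gamma> \<le> 1"
    and v: "0 \<le> v" "v \<le> 1" "pnorm \<beta> v 1 = v + (1 - v) / \<alpha>"
  defines "g \<equiv> vine_gauge \<alpha> \<beta> \<gamma>"
  shows "attains_min g {1, 3}" "tail_eta g {1, 3} = inverse (pnorm \<beta> v 1)"
proof -
  define x :: "real^3" where "x = vector [1, v, 1]"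
  have x: "x$1 = 1" "x$2 = v" "x$3 = 1" by (simp_all add: x_def)
  have reg: "x \<in> tail_region {1, 3}"
    using v by (auto simp: tail_region_def forall_3 x)
  have gx: "g x = pnorm \<beta> v 1"
    using assms x vine_gauge_eq_pnorm[of \<alpha> \<beta> x \<gamma>] by (simp add: vine_L_pnorm)
  have min: "g x \<le> g y" if "y \<in> tail_region {1, 3}" for y
  proof (cases "v \<le> y$2")
    case True
    have "pnorm \<beta> v 1 \<le> pnorm \<beta> (y$2) (y$3)"
      using assms True that by (intro pnorm_mono) (auto simp: tail_region_def)
    also have "\<dots> \<le> g y"
      unfolding g_def using assms True by (intro vine_gauge_ge_pnorm) auto
    finally show ?thesis by (simp add: gx)
  next
    case False
    have y: "1 \<le> y$1" using that by (auto simp: tail_region_def)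
    have "0 \<le> (1/\<alpha> - 1) * (v - y$2)"
      using assms False by (intro mult_nonneg_nonneg) auto
    then have "v + (1 - v) / \<alpha> \<le> y$2 + (1 - y$2) / \<alpha>"
      by (simp add: algebra_simps diff_divide_distrib)
    also have "\<dots> \<le> y$2 + (y$1 - y$2) / \<alpha>"
      using assms(1) y by (simp add: divide_right_mono)
    also have "\<dots> \<le> g y"
      unfolding g_def using assms False y by (intro vine_gauge_ge_affine) auto
    finally show ?thesis by (simp add: gx v)
  qed
  show "attains_min g {1, 3}" "tail_eta g {1, 3} = inverse (pnorm \<beta> v 1)"
    using tail_eta_minimizer[where g = g, OF reg min] by (simp_all add: gx)
qed

lemma crossing_unique:
  assumes "0 < \<alpha>" "\<alpha> < 1" "0 < \<beta>"
  obtains v where "{w \<in> {0..}. pnorm \<beta> w 1 - (1 - w) / \<alpha> - w = 0} = {v}" "v \<in> {0<..<1}"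
proof -
  define h where "h w = pnorm \<beta> w 1 - (1 - w) / \<alpha> - w" for w
  \<comment> \<open>Collecting the linear terms shows that \<open>h\<close> has slope at least \<open>1/\<alpha> - 1 > 0\<close>.\<close>
  have h_eq: "h w = pnorm \<beta> w 1 - 1/\<alpha> + (1/\<alpha> - 1) * w" for w
    by (simp add: h_def algebra_simps diff_divide_distrib)
  have h_less: "h w < h w'" if "0 \<le> w" "w < w'" for w w'
  proof -
    have "pnorm \<beta> w 1 \<le> pnorm \<beta> w' 1"
      using assms that by (intro pnorm_mono) auto
    moreover have "(1/\<alpha> - 1) * w < (1/\<alpha> - 1) * w'"
      using assms that by (intro mult_strict_left_mono) auto
    ultimately show ?thesis by (simp add: h_eq)
  qed
  have "continuous_on {0..1} h"
    unfolding h_def pnorm_def using assms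
    by (intro continuous_intros continuous_on_powr') (auto simp: add_nonneg_eq_0_iff)
  moreover have h0: "h 0 < 0" using assms by (simp add: h_def pnorm_def)
  moreover have h1: "0 < h 1"
    using assms gr_one_powr[of 2 \<beta>] by (simp add: h_def pnorm_def)
  ultimately obtain v where v: "0 \<le> v" "v \<le> 1" "h v = 0"
    using IVT'[of h 0 0 1] by auto
  have "v \<in> {0<..<1}"
    using v h0 h1 by (cases "v = 0"; cases "v = 1") auto
  moreover have "{w \<in> {0..}. h w = 0} = {v}"
  proof -
    have "v \<in> {w \<in> {0..}. h w = 0}" using v by simp
    moreover have "w = v" if "w \<in> {w \<in> {0..}. h w = 0}" for w
    proof -
      have "0 \<le> w" "h w = 0" using that by simp_all
      then show ?thesis using h_less[of w v] h_less[of v w] v by linarith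
    qed
    ultimately show ?thesis by blast
  qed
  ultimately show thesis using that unfolding h_def by blast
qed

theorem mainTheorem11:
  fixes \<alpha> \<beta> \<gamma> :: real
  assumes "\<alpha> \<in> {0<..<1}" and "\<beta> \<in> {0<..<1}" and "\<gamma> \<in> {0<..<1}"
  defines "g \<equiv> vine_gauge \<alpha> \<beta> \<gamma>"
  shows "attains_min g {1, 2, 3} \<and> tail_eta g {1, 2, 3} = 1 / 2 powr \<beta> \<and>
    attains_min g {1, 3} \<and>
    (\<exists>v. {w \<in> {0..}. (1 + w powr (1/\<beta>)) powr \<beta> - (1 - w) / \<alpha> - w = 0} = {v} \<and>
         v \<in> {0<..<1} \<and>
         tail_eta g {1, 3} = (1 + v powr (1/\<beta>)) powr (-\<beta>))"
proof -
  have p: "pnorm \<beta> w 1 = (1 + w powr (1/\<beta>)) powr \<beta>" for w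
    by (simp add: pnorm_def add.commute)
  obtain v where v: "{w \<in> {0..}. pnorm \<beta> w 1 - (1 - w) / \<alpha> - w = 0} = {v}" "v \<in> {0<..<1}"
    using crossing_unique[of \<alpha> \<beta>] assms by auto
  have "v \<in> {w \<in> {0..}. pnorm \<beta> w 1 - (1 - w) / \<alpha> - w = 0}"
    using v(1) by blast
  then have "pnorm \<beta> v 1 = v + (1 - v) / \<alpha>" by simp
  then have "attains_min g {1, 3}" "tail_eta g {1, 3} = inverse (pnorm \<beta> v 1)"
    using tail_eta_13[of \<alpha> \<beta> \<gamma> v] assms v(2) by auto
  moreover have "attains_min g {1, 2, 3}" "tail_eta g {1, 2, 3} = 1 / 2 powr \<beta>"
    using tail_eta_123[of \<alpha> \<beta> \<gamma>] assms by auto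
  ultimately show ?thesis
    using v unfolding p powr_minus by blast
qed

end
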